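(* For $r\ge1$ let \[ F_r(w_1,\dots,w_r)=\sum_{n_1,\dots,n_r\ge0}\frac{w_1^{n_1}\cdots w_r^{n_r}}{n_1!\cdots n_r!}\,\zeta_r(-n_1,\dots,-n_r) \] (as a formal power series), and let $F_B(w)=\frac{w}{e^w-1}=\sum_{n\ge0}B_n\frac{w^n}{n!}$. Then \[ F_1(w_1)=\frac{1-F_B(-w_1)}{w_1}, \] and for $r\ge2$ \[ F_r(w_1,\dots,w_r)=\frac{1}{w_r}\Big[F_{r-1}(w_1,\dots,w_{r-1})-F_B(-w_r)\,F_{r-1}(w_1,\dots,w_{r-2},w_{r-1}+w_r)\Big]. \]
   Context: Bernoulli numbers $B_m$ are defined by $\frac{t}{e^t-1}=\sum_{m\ge0}B_m\frac{t^m}{m!}$. For positive integers $a_1,\dots,a_k$, define recursively $V(a_1)=B_{a_1}/a_1$ and, for $k\ge2$, \[ V(a_1,\dots,a_k)=\frac{1}{a_k}\sum_{j=0}^{a_k}\binom{a_k}{j}B_{a_k-j}V(a_1,\dots,a_{k-2},a_{k-1}+j). \] The multiple zeta values at negative integers (Sadaoui's analytic continuation of the Euler–Zagier multiple zeta function, in the paper's closed form) are \[ \zeta_r(-n_1,\dots,-n_r)=(-1)^{n_1+\dots+n_r}V(n_1+1,\dots,n_r+1) \] for nonnegative integers $n_i$. *)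

theory Defs
  imports
    Complex_Main
    "HOL-Library.Multiset_Order"
    "HOL-Library.Groups_Big_Fun"
    "HOL-Computational_Algebra.Formal_Power_Series"
    "HOL-Computational_Algebra.Polynomial_Factorial"
begin

section \<open>Formal power series in the indeterminates $w_0, w_1, w_2, \dots$\<close>

text \<open>
  A monomial is a finite multiset of variable indices: the multiset \<open>m\<close> stands for
  the product of all $w_i^{e_i}$ with \<open>e\<^sub>i = count m i\<close>, so that monomials multiply by
  multiset union. A power series is an arbitrary family of coefficients.
\<close>

typedef 'a mps = "UNIV :: (nat multiset \<Rightarrow> 'a) set"
  morphisms mps_coeff Abs_mps ..

setup_lifting type_definition_mps

lemma mps_eqI: "(\<And>m. mps_coeff f m = mps_coeff g m) \<Longrightarrow> f = g"
  by (simp add: mps_coeff_inject[symmetric] fun_eq_iff)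

definition splits :: "nat multiset \<Rightarrow> (nat multiset \<times> nat multiset) set" where
  "splits m = {(a, b). a + b = m}"

lemma mem_splits_iff: "(a, b) \<in> splits m \<longleftrightarrow> a + b = m"
  by (simp add: splits_def)

lemma finite_splits [simp]: "finite (splits m)"
proof (induction m)
  case empty
  have "splits {#} = {({#}, {#})}" by (auto simp: splits_def)
  then show ?case by simp
next
  case (add x m)
  have "splits (add_mset x m) \<subseteq>
      (\<lambda>(a, b). (add_mset x a, b)) ` splits m \<union> (\<lambda>(a, b). (a, add_mset x b)) ` splits m"
  proof
    fix p assume "p \<in> splits (add_mset x m)"
    then obtain a b where p: "p = (a, b)" and ab: "a + b = add_mset x m"
      by (auto simp: splits_def)
    from ab have "x \<in># a \<or> x \<in># b" by (metis union_iff union_single_eq_member)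
    then show "p \<in> (\<lambda>(a, b). (add_mset x a, b)) ` splits m \<union> (\<lambda>(a, b). (a, add_mset x b)) ` splits m"
    proof
      assume "x \<in># a"
      then obtain a' where a': "a = add_mset x a'" by (metis insert_DiffM)
      with ab have "(a', b) \<in> splits m" by (simp add: splits_def)
      with p a' show ?thesis by force
    next
      assume "x \<in># b"
      then obtain b' where b': "b = add_mset x b'" by (metis insert_DiffM)
      with ab have "(a, b') \<in> splits m" by (simp add: splits_def)
      with p b' show ?thesis by force
    qed
  qed
  then show ?case using add.IH by (meson finite_UnI finite_imageI finite_subset)
qed

instantiation mps :: (comm_ring_1) comm_ring_1
begin

lift_definition zero_mps :: "'a mps" is "\<lambda>_. 0" .
lift_definition one_mps :: "'a mps" is "\<lambda>m. if m = {#} then 1 else 0" .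
lift_definition plus_mps :: "'a mps \<Rightarrow> 'a mps \<Rightarrow> 'a mps" is "\<lambda>f g m. f m + g m" .
lift_definition minus_mps :: "'a mps \<Rightarrow> 'a mps \<Rightarrow> 'a mps" is "\<lambda>f g m. f m - g m" .
lift_definition uminus_mps :: "'a mps \<Rightarrow> 'a mps" is "\<lambda>f m. - f m" .
lift_definition times_mps :: "'a mps \<Rightarrow> 'a mps \<Rightarrow> 'a mps" is
  "\<lambda>f g m. \<Sum>(a, b) \<in> splits m. f a * g b" .

instance
proof
  fix f g h :: "'a mps"
  show "f + g + h = f + (g + h)" by transfer (simp add: add.assoc)
  show "f + g = g + f" by transfer (simp add: add.commute)
  show "0 + f = f" by transfer simp
  show "- f + f = 0" by transfer simp
  show "f - g = f + - g" by transfer simp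
  show "(f + g) * h = f * h + g * h"
    by transfer (simp add: distrib_right sum.distrib case_prod_unfold)
  show "(0 :: 'a mps) \<noteq> 1" by transfer (metis zero_neq_one)
  show "f * g = g * f"
  proof transfer
    fix f g :: "nat multiset \<Rightarrow> 'a"
    have "(\<Sum>(a, b)\<in>splits m. f a * g b) = (\<Sum>(a, b)\<in>splits m. g a * f b)" for m
      by (rule sum.reindex_bij_witness[of _ prod.swap prod.swap])
        (auto simp: splits_def add.commute mult.commute)
    then show "(\<lambda>m. \<Sum>(a, b)\<in>splits m. f a * g b) = (\<lambda>m. \<Sum>(a, b)\<in>splits m. g a * f b)"
      by blast
  qed
  show "1 * f = f"
  proof transfer
    fix f :: "nat multiset \<Rightarrow> 'a"
    have "(\<Sum>(a, b)\<in>splits m. (if a = {#} then 1 else 0) * f b) = f m" for m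
    proof -
      have "(\<Sum>(a, b)\<in>splits m. (if a = {#} then 1 else 0) * f b)
          = (\<Sum>(a, b)\<in>{({#} :: nat multiset, m)}. (if a = {#} then 1 else 0) * f b)"
        by (rule sum.mono_neutral_right) (auto simp: mem_splits_iff split: if_splits)
      then show ?thesis by simp
    qed
    then show "(\<lambda>m. \<Sum>(a, b)\<in>splits m. (if a = {#} then 1 else 0) * f b) = f" by blast
  qed
  show "f * g * h = f * (g * h)"
  proof transfer
    fix f g h :: "nat multiset \<Rightarrow> 'a"
    have "(\<Sum>(a, b)\<in>splits m. (\<Sum>(c, d)\<in>splits a. f c * g d) * h b)
        = (\<Sum>(a, b)\<in>splits m. f a * (\<Sum>(c, d)\<in>splits b. g c * h d))" for m
    proof -
      have "(\<Sum>(a, b)\<in>splits m. (\<Sum>(c, d)\<in>splits a. f c * g d) * h b)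
          = (\<Sum>p\<in>splits m. \<Sum>q\<in>splits (fst p). f (fst q) * g (snd q) * h (snd p))"
        by (simp add: sum_distrib_right case_prod_unfold)
      also have "\<dots> = (\<Sum>(p, q)\<in>Sigma (splits m) (\<lambda>p. splits (fst p)).
          f (fst q) * g (snd q) * h (snd p))"
        by (rule sum.Sigma) auto
      also have "\<dots> = (\<Sum>(p, q)\<in>Sigma (splits m) (\<lambda>p. splits (snd p)).
          f (fst p) * (g (fst q) * h (snd q)))"
        by (rule sum.reindex_bij_witness
            [of _ "\<lambda>((a, b), (c, d)). ((a + c, d), (a, c))" "\<lambda>((a, b), (c, d)). ((c, d + b), (d, b))"])
          (auto simp: splits_def add.assoc mult.assoc)
      also have "\<dots> = (\<Sum>p\<in>splits m. \<Sum>q\<in>splits (snd p). f (fst p) * (g (fst q) * h (snd q)))"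
        by (rule sum.Sigma[symmetric]) auto
      also have "\<dots> = (\<Sum>(a, b)\<in>splits m. f a * (\<Sum>(c, d)\<in>splits b. g c * h d))"
        by (simp add: sum_distrib_left case_prod_unfold)
      finally show ?thesis .
    qed
    then show "(\<lambda>m. \<Sum>(a, b)\<in>splits m. (\<Sum>(c, d)\<in>splits a. f c * g d) * h b)
        = (\<lambda>m. \<Sum>(a, b)\<in>splits m. f a * (\<Sum>(c, d)\<in>splits b. g c * h d))"
      by blast
  qed
qed

end

instance mps :: (idom) idom
proof
  fix f g :: "'a mps"
  assume "f \<noteq> 0" "g \<noteq> 0"
  then obtain a0 b0 where "mps_coeff f a0 \<noteq> 0" "mps_coeff g b0 \<noteq> 0"
    by (metis mps_eqI zero_mps.rep_eq)
  define a where "a = (LEAST a. mps_coeff f a \<noteq> 0)"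
  define b where "b = (LEAST b. mps_coeff g b \<noteq> 0)"
  have a: "mps_coeff f a \<noteq> 0" "\<And>c. mps_coeff f c \<noteq> 0 \<Longrightarrow> a \<le> c"
    unfolding a_def by (rule LeastI, fact) (rule Least_le)
  have b: "mps_coeff g b \<noteq> 0" "\<And>c. mps_coeff g c \<noteq> 0 \<Longrightarrow> b \<le> c"
    unfolding b_def by (rule LeastI, fact) (rule Least_le)
  have "mps_coeff (f * g) (a + b) = (\<Sum>(c, d)\<in>splits (a + b). mps_coeff f c * mps_coeff g d)"
    by (simp add: times_mps.rep_eq)
  also have "\<dots> = (\<Sum>(c, d)\<in>{(a, b)}. mps_coeff f c * mps_coeff g d)"
  proof (rule sum.mono_neutral_right)
    show "\<forall>p\<in>splits (a + b) - {(a, b)}. (case p of (c, d) \<Rightarrow> mps_coeff f c * mps_coeff g d) = 0"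
    proof
      fix p assume p: "p \<in> splits (a + b) - {(a, b)}"
      obtain c d where cd: "p = (c, d)" by fastforce
      have eq: "c + d = a + b" and ne: "(c, d) \<noteq> (a, b)"
        using p cd by (auto simp: mem_splits_iff)
      have "mps_coeff f c = 0 \<or> mps_coeff g d = 0"
      proof (rule ccontr)
        assume "\<not> (mps_coeff f c = 0 \<or> mps_coeff g d = 0)"
        with a b have le: "a \<le> c" "b \<le> d" by auto
        have "c = a"
        proof (rule ccontr)
          assume "c \<noteq> a"
          with le have "a + b < c + d" by (intro add_less_le_mono) auto
          with eq show False by simp
        qed
        with eq ne show False by simp
      qed
      with cd show "(case p of (c, d) \<Rightarrow> mps_coeff f c * mps_coeff g d) = 0" by auto
    qed
  qed (auto simp: mem_splits_iff)
  also have "\<dots> \<noteq> 0" using a b by simp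
  finally show "f * g \<noteq> 0" by (metis zero_mps.rep_eq)
qed

lift_definition W :: "nat \<Rightarrow> 'a :: comm_ring_1 mps" is
  "\<lambda>i m. if m = {#i#} then 1 else 0" .

text \<open>
  \<open>mps_subst s f\<close> is $f(s_0, s_1, s_2, \dots)$. The sum over all monomials \<open>a\<close> is
  taken coefficientwise, and \<open>Sum_any\<close> is the sum over the support, with value 0 if that
  is infinite. The support is finite if \<open>f\<close> involves only finitely many indeterminates and the
  series substituted for them have no constant term; see \<open>mps_subst_finite_support\<close>.
  Likewise for \<open>fps_at_mps f g\<close>, which is $f(g)$ for a series \<open>f\<close> in one indeterminate.
\<close>

definition mps_subst :: "(nat \<Rightarrow> 'a :: comm_ring_1 mps) \<Rightarrow> 'a mps \<Rightarrow> 'a mps" where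
  "mps_subst s f =
     Abs_mps (\<lambda>m. Sum_any (\<lambda>a. mps_coeff f a * mps_coeff (\<Prod>i\<in>#a. s i) m))"

definition fps_at_mps :: "'a :: comm_ring_1 fps \<Rightarrow> 'a mps \<Rightarrow> 'a mps" where
  "fps_at_mps f g =
     Abs_mps (\<lambda>m. Sum_any (\<lambda>n. fps_nth f n * mps_coeff (g ^ n) m))"

lemma mps_coeff_prod_mset_eq_0:
  assumes "\<And>i. i \<in># a \<Longrightarrow> mps_coeff (s i) {#} = 0" "size m < size a"
  shows "mps_coeff (\<Prod>i\<in>#a. s i :: 'a :: comm_ring_1 mps) m = 0"
  using assms
proof (induction a arbitrary: m)
  case (add x a)
  have "mps_coeff (s x) c * mps_coeff (\<Prod>i\<in>#a. s i) d = 0" if "(c, d) \<in> splits m" for c d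
  proof (cases "c = {#}")
    case True
    then show ?thesis using add.prems(1)[of x] by simp
  next
    case False
    have "size c + size d = size m" using that by (auto simp: splits_def)
    moreover have "size c > 0" using False by (simp add: nonempty_has_size)
    ultimately have "size d < size a" using add.prems(2) by simp
    then show ?thesis using add.IH[of d] add.prems(1) by simp
  qed
  then show ?case by (auto simp: times_mps.rep_eq intro!: sum.neutral)
qed simp

lemma mps_subst_finite_support:
  assumes "finite I" "\<And>a. mps_coeff f a \<noteq> 0 \<Longrightarrow> set_mset a \<subseteq> I"
    and "\<And>i. i \<in> I \<Longrightarrow> mps_coeff (s i) {#} = 0"
  shows "finite {a. mps_coeff f a * mps_coeff (\<Prod>i\<in>#a. s i :: 'a :: comm_ring_1 mps) m \<noteq> 0}"
proof -
  have "{a. mps_coeff f a * mps_coeff (\<Prod>i\<in>#a. s i) m \<noteq> 0}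
      \<subseteq> mset ` {xs. set xs \<subseteq> I \<and> length xs \<le> size m}"
  proof
    fix a assume "a \<in> {a. mps_coeff f a * mps_coeff (\<Prod>i\<in>#a. s i) m \<noteq> 0}"
    then have nz: "mps_coeff f a \<noteq> 0" "mps_coeff (\<Prod>i\<in>#a. s i) m \<noteq> 0" by auto
    have I: "set_mset a \<subseteq> I" using nz assms(2) by blast
    have le: "size a \<le> size m"
    proof (rule ccontr)
      assume "\<not> size a \<le> size m"
      then have "mps_coeff (\<Prod>i\<in>#a. s i) m = 0"
        using I assms(3) by (intro mps_coeff_prod_mset_eq_0) auto
      with nz show False by simp
    qed
    obtain xs where "a = mset xs" by (metis ex_mset)
    with I le show "a \<in> mset ` {xs. set xs \<subseteq> I \<and> length xs \<le> size m}" by auto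
  qed
  then show ?thesis
    by (rule finite_subset) (intro finite_imageI finite_lists_length_le assms(1))
qed

lemma fps_at_mps_finite_support:
  assumes "mps_coeff g {#} = 0"
  shows "finite {n. fps_nth f n * mps_coeff (g ^ n :: 'a :: comm_ring_1 mps) m \<noteq> 0}"
proof -
  have "mps_coeff (g ^ n) m = 0" if "size m < n" for n
    using mps_coeff_prod_mset_eq_0[of "replicate_mset n 0" "\<lambda>_. g" m] assms that by simp
  then have "{n. fps_nth f n * mps_coeff (g ^ n) m \<noteq> 0} \<subseteq> {..size m}"
    by (auto simp: not_less[symmetric])
  then show ?thesis by (rule finite_subset) simp
qed


section \<open>Multiple zeta values at negative integers\<close>

definition F_B :: "complex fps" where
  "F_B = fps_X / (fps_exp 1 - 1)"

definition bernoulli :: "nat \<Rightarrow> complex" where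
  "bernoulli m = fact m * fps_nth F_B m"

text \<open>
  The recursion for $V$ acts on the last two arguments; \<open>V_rev\<close> takes the arguments in
  reverse order, so that it acts on the first two.
\<close>

fun V_rev :: "nat list \<Rightarrow> complex" where
  "V_rev [] = undefined"
| "V_rev [a] = bernoulli a / of_nat a"
| "V_rev (a # b # as) =
     1 / of_nat a * (\<Sum>j=0..a. of_nat (a choose j) * bernoulli (a - j) * V_rev ((b + j) # as))"

definition V :: "nat list \<Rightarrow> complex" where
  "V as = V_rev (rev as)"

lemma V_single: "V [a] = bernoulli a / of_nat a"
  by (simp add: V_def)

lemma V_snoc:
  "V (as @ [b, a]) =
     1 / of_nat a * (\<Sum>j=0..a. of_nat (a choose j) * bernoulli (a - j) * V (as @ [b + j]))"
  by (simp add: V_def)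

text \<open>\<open>zeta_neg [n\<^sub>1, \<dots>, n\<^sub>r]\<close> is $\zeta_r(-n_1, \dots, -n_r)$.\<close>

definition zeta_neg :: "nat list \<Rightarrow> complex" where
  "zeta_neg ns = (-1) ^ sum_list ns * V (map (\<lambda>n. n + 1) ns)"

definition F :: "nat \<Rightarrow> complex mps" where
  "F r = Abs_mps (\<lambda>m. if set_mset m \<subseteq> {1..r}
     then zeta_neg (map (count m) [1..<r + 1]) / (\<Prod>i=1..r. fact (count m i)) else 0)"

end

theory Submission
  imports Defs
begin

text \<open>
  After clearing the denominator $w_r$, both sides are compared monomial by monomial.
  Substituting $w_{r-1} + w_r$ for $w_{r-1}$ multiplies the coefficient at
  $w_{r-1}^b w_r^j$ by a binomial coefficient, which turns $1/(b+j)!$ into $1/(b!\,j!)$, and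
  multiplication by $F_B(-w_r)$ is then a convolution in the exponent of $w_r$. That convolution
  is the recursion for $V$ with $\binom{a}{j} B_{a-j}/a = (a-1)!\,[w^{a-j}]F_B/j!$. At
  exponent 0 of $w_r$ the two terms cancel because $B_0 = 1$.
\<close>

section \<open>Multiplication by an indeterminate and by a series in \<open>- W i\<close>\<close>

lemma mps_coeff_W_mult:
  "mps_coeff (W i * f) m = (if i \<in># m then mps_coeff f (m - {#i#}) else 0)"
proof -
  have "mps_coeff (W i * f) m = (\<Sum>(a, b)\<in>splits m. (if a = {#i#} then 1 else 0) * mps_coeff f b)"
    by (simp add: times_mps.rep_eq W.rep_eq)
  also have "\<dots> = (\<Sum>(a, b)\<in>(if i \<in># m then {({#i#}, m - {#i#})} else {}).
      (if a = {#i#} then 1 else 0) * mps_coeff f b)"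
    by (rule sum.mono_neutral_right) (auto simp: mem_splits_iff split: if_splits)
  finally show ?thesis by simp
qed

text \<open>Permits division by an indeterminate in the field of fractions.\<close>

lemma W_neq_0: "W i \<noteq> 0"
  by (metis W.rep_eq zero_mps.rep_eq zero_neq_one)

lemma mps_coeff_uminus_W_power:
  "mps_coeff ((- W i :: 'a :: comm_ring_1 mps) ^ n) m = (if m = replicate_mset n i then (-1) ^ n else 0)"
proof (induction n arbitrary: m)
  case 0
  then show ?case by (simp add: one_mps.rep_eq)
next
  case (Suc n)
  have "mps_coeff ((- W i :: 'a mps) ^ Suc n) m = - mps_coeff (W i * (- W i) ^ n) m"
    by (simp add: uminus_mps.rep_eq)
  also have "\<dots> = (if m = replicate_mset (Suc n) i then (-1) ^ Suc n else 0)"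
    unfolding mps_coeff_W_mult Suc.IH by (auto dest: multi_member_split)
  finally show ?case .
qed

text \<open>Among the powers of \<open>- W i\<close> only the one with exponent
  \<open>size m\<close> can contain \<open>m\<close>, so the sum over all powers has at most one
  nonzero term.\<close>

lemma mps_coeff_fps_at_uminus_W:
  "mps_coeff (fps_at_mps g (- W i)) m =
     (if m = replicate_mset (size m) i then (-1) ^ size m * fps_nth g (size m) else 0)"
proof -
  have "mps_coeff (fps_at_mps g (- W i)) m = (\<Sum>n\<in>{size m}. fps_nth g n * mps_coeff ((- W i) ^ n) m)"
    unfolding fps_at_mps_def Abs_mps_inverse[OF UNIV_I]
    by (rule Sum_any.expand_superset) (auto simp: mps_coeff_uminus_W_power split: if_splits)
  then show ?thesis by (simp add: mps_coeff_uminus_W_power mult.commute)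
qed

text \<open>The first factor contains only pure powers of \<open>W i\<close>, so a splitting of
  \<open>m\<close> contributes only if its first part consists of copies of
  \<open>i\<close>.\<close>

lemma mps_coeff_fps_at_uminus_W_mult:
  "mps_coeff (fps_at_mps g (- W i) * f) m =
     (\<Sum>k\<le>count m i. (-1) ^ k * fps_nth g k * mps_coeff f (m - replicate_mset k i))"
proof -
  let ?h = "\<lambda>k. (replicate_mset k i, m - replicate_mset k i)"
  have "mps_coeff (fps_at_mps g (- W i) * f) m =
      (\<Sum>(a, b)\<in>?h ` {..count m i}. mps_coeff (fps_at_mps g (- W i)) a * mps_coeff f b)"
    unfolding times_mps.rep_eq
  proof (rule sum.mono_neutral_right)
    show "?h ` {..count m i} \<subseteq> splits m"
      by (auto simp: mem_splits_iff count_le_replicate_mset_subset_eq)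
    show "\<forall>x\<in>splits m - ?h ` {..count m i}.
        (case x of (a, b) \<Rightarrow> mps_coeff (fps_at_mps g (- W i)) a * mps_coeff f b) = 0"
    proof clarify
      fix a b assume ab: "(a, b) \<in> splits m" "(a, b) \<notin> ?h ` {..count m i}"
      have "a \<noteq> replicate_mset (size a) i"
      proof
        assume a: "a = replicate_mset (size a) i"
        have m: "m = a + b" using ab(1) by (simp add: mem_splits_iff)
        have "size a \<le> count m i" using a m by (metis count_replicate_mset count_union le_add1)
        moreover have "(a, b) = ?h (size a)" using a m by (metis add_diff_cancel_left')
        ultimately show False using ab(2) by blast
      qed
      then show "mps_coeff (fps_at_mps g (- W i)) a * mps_coeff f b = 0"
        by (simp add: mps_coeff_fps_at_uminus_W)
    qed
  qed simp
  also have "\<dots> = (\<Sum>k\<le>count m i. mps_coeff (fps_at_mps g (- W i)) (replicate_mset k i)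
      * mps_coeff f (m - replicate_mset k i))"
    by (subst sum.reindex) (auto intro!: inj_onI dest: arg_cong[of _ _ size])
  finally show ?thesis by (simp add: mps_coeff_fps_at_uminus_W)
qed

section \<open>Substituting the sum of two indeterminates for one of them\<close>

lemma count_image_merge:
  assumes "p \<noteq> q"
  shows "count (image_mset (id(q := p)) m) i =
    (if i = p then count m p + count m q else if i = q then 0 else count m i)"
  using assms by (induction m) auto

text \<open>Each factor \<open>W p\<close> becomes \<open>W p + W q\<close>. Expanding gives exactly
  the monomials that turn back into \<open>a\<close> when \<open>q\<close> is renamed to
  \<open>p\<close>, and the coefficient counts the ways to choose the factors that supply
  \<open>W q\<close>. The induction reproduces Pascal's rule.\<close>

lemma mps_coeff_prod_mset_merge:
  fixes p q :: nat and s :: "nat \<Rightarrow> 'a :: comm_ring_1 mps" and h :: "nat \<Rightarrow> nat"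
  defines "s \<equiv> W(p := W p + W q)" and "h \<equiv> id(q := p)"
  assumes pq: "p \<noteq> q" and "q \<notin># a"
  shows "mps_coeff (\<Prod>i\<in>#a. s i) m =
    (if image_mset h m = a then of_nat (count a p choose count m q) else 0)"
proof -
  have s: "s p = W p + W q" "\<And>x. x \<noteq> p \<Longrightarrow> s x = W x" by (auto simp: s_def)
  have h: "h q = p" "\<And>x. x \<noteq> q \<Longrightarrow> h x = x" by (auto simp: h_def)
  show ?thesis using \<open>q \<notin># a\<close>
  proof (induction a arbitrary: m)
    case empty
    then show ?case by (simp add: one_mps.rep_eq)
  next
    case (add x a)
    have q: "q \<notin># a" "x \<noteq> q" using add.prems by auto
    note IH = add.IH[OF q(1)]
    show ?case
    proof (cases "x = p")
      case False
      show ?thesis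
      proof (cases "x \<in># m")
        case True
        then obtain m' where "m = add_mset x m'" by (metis insert_DiffM)
        then show ?thesis using False q by (simp add: mps_coeff_W_mult IH s h)
      next
        case nx: False
        have "x \<notin># image_mset h m" using nx False h by (metis imageE set_image_mset)
        then have "image_mset h m \<noteq> add_mset x a" by (metis union_single_eq_member)
        then show ?thesis using False nx by (simp add: mps_coeff_W_mult s)
      qed
    next
      case True
      let ?P = "\<Prod>i\<in>#a. s i"
      have "mps_coeff (\<Prod>i\<in>#add_mset x a. s i) m
          = mps_coeff (W p * ?P) m + mps_coeff (W q * ?P) m"
        using True by (simp add: distrib_right plus_mps.rep_eq s)
      also have "\<dots> = (if p \<in># m then mps_coeff ?P (m - {#p#}) else 0)
          + (if q \<in># m then mps_coeff ?P (m - {#q#}) else 0)"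
        by (simp only: mps_coeff_W_mult)
      also have "\<dots> = (if image_mset h m = add_mset x a
          then of_nat (count (add_mset x a) p choose count m q) else 0)"
      proof (cases "image_mset h m = add_mset x a")
        case eq: True
        have "count (image_mset h m) p = count m p + count m q"
          using count_image_merge[OF pq, of m p] by (simp add: h_def)
        then have c: "count m p + count m q = Suc (count a p)"
          using eq True by simp
        have ep: "image_mset h (m - {#p#}) = a" if "p \<in># m"
          using that eq True pq by (simp add: image_mset_Diff h)
        have eq': "image_mset h (m - {#q#}) = a" if "q \<in># m"
          using that eq True pq by (simp add: image_mset_Diff h)
        \<comment> \<open>If \<open>p\<close> does not occur in \<open>m\<close>, then by
          \<open>c\<close> the lower index exceeds the upper one and the binomial coefficient is 0
          too.\<close>
        have "(if p \<in># m then mps_coeff ?P (m - {#p#}) else 0) = of_nat (count a p choose count m q)"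
          using ep c pq by (auto simp: IH not_in_iff binomial_eq_0)
        moreover have "(if q \<in># m then mps_coeff ?P (m - {#q#}) else 0)
            = (case count m q of 0 \<Rightarrow> 0 | Suc k \<Rightarrow> of_nat (count a p choose k))"
          using eq' by (auto simp: IH not_in_iff split: nat.splits)
        \<comment> \<open>The two contributions add up by Pascal's rule.\<close>
        ultimately show ?thesis using eq True by (auto split: nat.splits)
      next
        case neq: False
        have "image_mset h (m - {#p#}) \<noteq> a" if "p \<in># m"
          using that neq True pq by (auto dest!: multi_member_split simp: h)
        moreover have "image_mset h (m - {#q#}) \<noteq> a" if "q \<in># m"
          using that neq True pq by (auto dest!: multi_member_split simp: h)
        ultimately show ?thesis using neq by (simp add: IH)
      qed
      finally show ?thesis .
    qed
  qed
qed

text \<open>As \<open>f\<close> is free of \<open>q\<close>, the only monomial of \<open>f\<close>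
  whose expansion can contain \<open>m\<close> is \<open>m\<close> with \<open>q\<close> renamed to
  \<open>p\<close>; the sum over monomials collapses to that term.\<close>

lemma mps_coeff_subst_merge:
  fixes f :: "'a :: comm_ring_1 mps"
  assumes "p \<noteq> q" "\<And>a. q \<in># a \<Longrightarrow> mps_coeff f a = 0"
  shows "mps_coeff (mps_subst (W(p := W p + W q)) f) m =
    of_nat (count m p + count m q choose count m q) * mps_coeff f (image_mset (id(q := p)) m)"
proof -
  let ?m = "image_mset (id(q := p)) m" and ?s = "W(p := W p + W q) :: nat \<Rightarrow> 'a mps"
  have q: "q \<notin># ?m"
    using assms(1) by auto
  have "mps_coeff (mps_subst ?s f) m
      = (\<Sum>a\<in>{?m}. mps_coeff f a * mps_coeff (\<Prod>i\<in>#a. ?s i) m)"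
    unfolding mps_subst_def Abs_mps_inverse[OF UNIV_I]
  proof (rule Sum_any.expand_superset)
    show "{a. mps_coeff f a * mps_coeff (\<Prod>i\<in>#a. ?s i) m \<noteq> 0} \<subseteq> {?m}"
    proof
      fix a assume "a \<in> {a. mps_coeff f a * mps_coeff (\<Prod>i\<in>#a. ?s i) m \<noteq> 0}"
      then have "mps_coeff f a \<noteq> 0" and nz: "mps_coeff (\<Prod>i\<in>#a. ?s i) m \<noteq> 0"
        by (auto simp del: fun_upd_apply)
      then have "q \<notin># a" using assms(2) by blast
      then show "a \<in> {?m}"
        using nz mps_coeff_prod_mset_merge[OF assms(1), where 'a = 'a] by (metis singletonI)
    qed
  qed simp
  also have "\<dots> = mps_coeff f ?m * mps_coeff (\<Prod>i\<in>#?m. ?s i) m"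
    by (simp del: fun_upd_apply)
  also have "\<dots> = mps_coeff f ?m * of_nat (count m p + count m q choose count m q)"
    unfolding mps_coeff_prod_mset_merge[OF assms(1) q] count_image_merge[OF assms(1)] by simp
  finally show ?thesis by (simp only: mult.commute)
qed

section \<open>Bernoulli series and the recursion for zeta values\<close>

lemma fps_nth_F_B_0: "fps_nth F_B 0 = 1"
proof -
  \<comment> \<open>Numerator and denominator of \<open>F_B\<close> both have constant term 0.
    Cancelling \<open>fps_X\<close> leaves a denominator that is a unit.\<close>
  have "fps_exp (1 :: complex) - 1 = fps_X * Abs_fps (\<lambda>n. 1 / fact (Suc n))"
    by (rule fps_ext) (simp add: fps_X_mult_nth Suc_diff_1 del: fact_Suc split: nat.split)
  then have "F_B = fps_X * 1 / (fps_X * Abs_fps (\<lambda>n. 1 / fact (Suc n)))"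
    by (simp add: F_B_def)
  also have "\<dots> = 1 / Abs_fps (\<lambda>n. 1 / fact (Suc n))"
    by (rule div_mult_mult1) simp
  finally have "F_B = 1 / Abs_fps (\<lambda>n. 1 / fact (Suc n))" .
  show ?thesis unfolding \<open>F_B = 1 / _\<close> by (simp add: fps_divide_unit)
qed

text \<open>The recursion for \<open>V\<close> rewritten for \<open>zeta_neg\<close>. The arguments
  of \<open>V\<close> are larger by one, hence the upper limit \<open>Suc n\<close>.\<close>

lemma zeta_neg_snoc:
  "zeta_neg (ns @ [b, n]) = - (\<Sum>j\<le>Suc n. (-1) ^ (Suc n - j) * fps_nth F_B (Suc n - j)
     * (fact n / fact j) * zeta_neg (ns @ [b + j]))"
proof -
  have "zeta_neg (ns @ [b, n]) = (\<Sum>j\<le>Suc n. (-1) ^ (sum_list ns + b + n) *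
      (1 / of_nat (Suc n) * (of_nat (Suc n choose j) * bernoulli (Suc n - j)
        * V (map (\<lambda>n. n + 1) ns @ [Suc (b + j)]))))"
    by (simp add: zeta_neg_def V_snoc sum_distrib_left atLeast0AtMost add.assoc
        del: binomial_Suc_Suc sum.atMost_Suc of_nat_Suc)
  also have "\<dots> = (\<Sum>j\<le>Suc n. - ((-1) ^ (Suc n - j) * fps_nth F_B (Suc n - j)
     * (fact n / fact j) * zeta_neg (ns @ [b + j])))"
  proof (rule sum.cong[OF refl])
    fix j assume "j \<in> {..Suc n}"
    then have j: "j \<le> Suc n" by simp
    \<comment> \<open>The exponents on the right add up to one more than the exponent on the left;
      this is the source of the minus sign.\<close>
    have sgn: "(-1 :: complex) ^ (sum_list ns + b + n)
        = - ((-1) ^ (Suc n - j) * (-1) ^ (sum_list ns + (b + j)))"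
      unfolding power_add[symmetric] using j by (simp add: power_add)
    have "of_nat (Suc n choose j) = (fact (Suc n) / (fact j * fact (Suc n - j)) :: complex)"
      using j by (rule binomial_fact)
    then have coeff: "1 / of_nat (Suc n) * (of_nat (Suc n choose j) * bernoulli (Suc n - j))
        = fps_nth F_B (Suc n - j) * (fact n / fact j)"
      by (simp add: bernoulli_def field_simps del: of_nat_Suc)
    show "(-1) ^ (sum_list ns + b + n) * (1 / of_nat (Suc n) * (of_nat (Suc n choose j)
        * bernoulli (Suc n - j) * V (map (\<lambda>n. n + 1) ns @ [Suc (b + j)])))
      = - ((-1) ^ (Suc n - j) * fps_nth F_B (Suc n - j) * (fact n / fact j)
        * zeta_neg (ns @ [b + j]))"
      unfolding sgn mult.assoc[symmetric] coeff[unfolded mult.assoc[symmetric]]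
      using coeff by (simp add: zeta_neg_def ac_simps del: binomial_Suc_Suc of_nat_Suc)
  qed
  finally show ?thesis by (simp only: sum_negf)
qed

section \<open>Coefficient comparison after clearing denominators\<close>

lemma mps_coeff_F:
  "mps_coeff (F r) m = (if set_mset m \<subseteq> {1..r}
     then zeta_neg (map (count m) [1..<r + 1]) / (\<Prod>i=1..r. fact (count m i)) else 0)"
  by (simp add: F_def Abs_mps_inverse)

text \<open>At exponent \<open>Suc k\<close> both sides equal $(-1)^k B_{k+1}/(k+1)!$. The constant
  terms vanish because $B_0 = 1$, and monomials with another indeterminate occur on neither
  side.\<close>

lemma W_mult_F_1: "W 1 * F 1 = 1 - fps_at_mps F_B (- W 1)"
proof (rule mps_eqI)
  fix m
  show "mps_coeff (W 1 * F 1) m = mps_coeff (1 - fps_at_mps F_B (- W 1)) m"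
  proof (cases "m = replicate_mset (size m) 1")
    case True
    then obtain n where m: "m = replicate_mset n 1" by blast
    show ?thesis
    proof (cases n)
      case 0
      then show ?thesis using m
        by (simp add: mps_coeff_W_mult minus_mps.rep_eq one_mps.rep_eq
            mps_coeff_fps_at_uminus_W fps_nth_F_B_0)
    next
      case (Suc k)
      then show ?thesis using m unfolding mps_coeff_W_mult
        by (simp add: minus_mps.rep_eq one_mps.rep_eq mps_coeff_F zeta_neg_def
            mps_coeff_fps_at_uminus_W V_single bernoulli_def field_simps del: of_nat_Suc)
    qed
  next
    case False
    have "\<not> set_mset (m - {#1#}) \<subseteq> {1}" if "1 \<in># m"
    proof
      assume "set_mset (m - {#1#}) \<subseteq> {1}"
      then have "set_mset m \<subseteq> {1}" by (metis insert_DiffM insert_subset set_mset_add_mset_insert singletonI that)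
      then show False using False by (metis set_mset_subset_singletonD)
    qed
    moreover have "m \<noteq> {#}" using False by auto
    ultimately show ?thesis using False
      by (simp add: mps_coeff_W_mult minus_mps.rep_eq one_mps.rep_eq mps_coeff_F
          mps_coeff_fps_at_uminus_W)
  qed
qed

lemma W_mult_F:
  fixes s :: nat
  defines "p \<equiv> Suc s" and "q \<equiv> Suc (Suc s)"
  shows "W q * F q = F p - fps_at_mps F_B (- W q) * mps_subst (W(p := W p + W q)) (F p)"
proof (rule mps_eqI)
  fix m
  let ?a = "count m q" and ?b = "count m p" and ?ns = "map (count m) [1..<s + 1]"
  let ?P = "\<Prod>i=1..s. fact (count m i) :: complex"
  have pq: "p \<noteq> q" by (simp add: p_def q_def)
  have Fq: "mps_coeff (F p) a = 0" if "q \<in># a" for a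
    using that by (auto simp: mps_coeff_F p_def q_def)
  \<comment> \<open>The cofactor coefficient left over when \<open>fps_at_mps F_B (- W q)\<close>
    takes up \<open>k\<close> of the factors \<open>W q\<close> of \<open>m\<close>.\<close>
  define R where "R k = mps_coeff (mps_subst (W(p := W p + W q)) (F p)) (m - replicate_mset k q)" for k
  have prod: "mps_coeff (fps_at_mps F_B (- W q) * mps_subst (W(p := W p + W q)) (F p)) m
      = (\<Sum>k\<le>?a. (-1) ^ k * fps_nth F_B k * R k)"
    by (simp add: mps_coeff_fps_at_uminus_W_mult R_def)
  have R: "R k = of_nat (?b + (?a - k) choose (?a - k))
      * mps_coeff (F p) (image_mset (id(q := p)) (m - replicate_mset k q))" for k
    unfolding R_def using pq
    by (subst mps_coeff_subst_merge[OF pq]) (simp_all add: Fq del: fun_upd_apply)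
  show "mps_coeff (W q * F q) m =
      mps_coeff (F p - fps_at_mps F_B (- W q) * mps_subst (W(p := W p + W q)) (F p)) m"
  proof (cases "set_mset m \<subseteq> {1..q}")
    \<comment> \<open>An index outside the range survives both the removal of copies of
      \<open>q\<close> and the renaming of \<open>q\<close> to \<open>p\<close>, so every
      coefficient involved is 0.\<close>
    case False
    then obtain i where i: "i \<in># m" "i \<notin> {1..q}" by blast
    then have iq: "i \<noteq> q" "i \<notin> {1..p}" by (auto simp: p_def q_def)
    have "R k = 0" for k
    proof -
      have "i \<in># m - replicate_mset k q" using i iq
        by (metis count_diff count_greater_zero_iff count_replicate_mset diff_zero)
      then have "i \<in># image_mset (id(q := p)) (m - replicate_mset k q)"
        using iq by force
      then show ?thesis using iq unfolding R mps_coeff_F by auto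
    qed
    moreover have "i \<in># m - {#q#}" using i iq by (metis in_diff_count count_single count_greater_zero_iff)
    ultimately show ?thesis using i iq
      unfolding minus_mps.rep_eq prod mps_coeff_W_mult mps_coeff_F by auto
  next
    case True
    \<comment> \<open>Here \<open>j\<close> is the exponent of \<open>W q\<close> left to the
      substituted series; the binomial coefficient cancels the factorial of
      \<open>?b + j\<close>.\<close>
    have Rj: "R (?a - j) = zeta_neg (?ns @ [?b + j]) / (?P * fact ?b * fact j)" if "j \<le> ?a" for j
    proof -
      let ?m = "image_mset (id(q := p)) (m - replicate_mset (?a - j) q)"
      note cm = count_image_merge[OF pq]
      have sub: "set_mset ?m \<subseteq> {1..p}"
      proof
        fix x assume "x \<in># ?m"
        then obtain y where "y \<in># m" "x = (id(q := p)) y" by (auto dest: in_diffD)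
        then show "x \<in> {1..p}" using True by (cases "y = q") (auto simp: p_def q_def)
      qed
      have cnt: "count ?m i = count m i" if "i \<le> s" for i
      proof -
        have "i \<noteq> p" "i \<noteq> q" using that by (auto simp: p_def q_def)
        then show ?thesis by (simp add: cm)
      qed
      have cntp: "count ?m p = ?b + j"
        using that pq by (simp add: cm)
      have list: "map (count ?m) [1..<p + 1] = ?ns @ [?b + j]"
        using cnt cntp by (auto simp: p_def)
      have pr: "(\<Prod>i=1..p. fact (count ?m i)) = ?P * fact (?b + j)"
        using cnt cntp by (simp add: p_def)
      have "R (?a - j) = of_nat (?b + j choose j) * (zeta_neg (?ns @ [?b + j]) / (?P * fact (?b + j)))"
        unfolding R mps_coeff_F list pr using sub that by simp
      also have "of_nat (?b + j choose j) = (fact (?b + j) / (fact j * fact ?b) :: complex)"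
        using binomial_fact[of j "?b + j"] by simp
      finally show ?thesis by simp
    qed
    \<comment> \<open>Reversing the sum makes the index agree with the one in
      \<open>zeta_neg_snoc\<close>.\<close>
    have "(\<Sum>k\<le>?a. (-1) ^ k * fps_nth F_B k * R k)
        = (\<Sum>j\<le>?a. (-1) ^ (?a - j) * fps_nth F_B (?a - j) * R (?a - j))"
      by (rule sum.reindex_bij_witness[of _ "\<lambda>j. ?a - j" "\<lambda>j. ?a - j"]) auto
    also have "\<dots> = (\<Sum>j\<le>?a. (-1) ^ (?a - j) * fps_nth F_B (?a - j)
        * (zeta_neg (?ns @ [?b + j]) / (?P * fact ?b * fact j)))"
      by (rule sum.cong) (auto simp: Rj)
    finally have conv: "(\<Sum>k\<le>?a. (-1) ^ k * fps_nth F_B k * R k) = \<dots>" .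
    show ?thesis
    proof (cases ?a)
      case 0
      have "set_mset m \<subseteq> {1..p}"
      proof
        fix x assume x: "x \<in># m"
        then have "x \<noteq> q" using 0 by (auto simp: not_in_iff[symmetric])
        then show "x \<in> {1..p}" using True x by (auto simp: p_def q_def)
      qed
      then have "mps_coeff (F p) m = zeta_neg (?ns @ [?b]) / (?P * fact ?b)"
        by (simp add: mps_coeff_F p_def)
      moreover have "q \<notin># m" using 0 by (simp add: not_in_iff)
      ultimately show ?thesis
        unfolding minus_mps.rep_eq prod conv mps_coeff_W_mult
        by (simp add: 0 fps_nth_F_B_0)
    next
      case (Suc n)
      then have qm: "q \<in># m" by (metis count_greater_zero_iff zero_less_Suc)
      have "mps_coeff (F q) (m - {#q#}) = zeta_neg (?ns @ [?b, n]) / (?P * fact ?b * fact n)"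
      proof -
        have "set_mset (m - {#q#}) \<subseteq> {1..q}" using True by (auto dest: in_diffD)
        moreover have "map (count (m - {#q#})) [1..<q + 1] = ?ns @ [?b, n]"
          using Suc by (simp add: p_def q_def)
        moreover have "(\<Prod>i=1..q. fact (count (m - {#q#}) i)) = ?P * fact ?b * (fact n :: complex)"
          using Suc by (simp add: p_def q_def)
        ultimately show ?thesis by (simp only: mps_coeff_F if_True)
      qed
      also have "\<dots> = - (\<Sum>j\<le>?a. (-1) ^ (?a - j) * fps_nth F_B (?a - j)
        * (zeta_neg (?ns @ [?b + j]) / (?P * fact ?b * fact j)))"
        unfolding zeta_neg_snoc Suc minus_divide_left[symmetric] sum_divide_distrib
        by (intro arg_cong[of _ _ uminus] sum.cong) (simp_all add: field_simps)
      finally have "mps_coeff (F q) (m - {#q#}) = \<dots>" .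
      \<comment> \<open>\<open>F p\<close> does not involve \<open>W q\<close>, so only the product
        contributes at \<open>m\<close>.\<close>
      moreover have "mps_coeff (F p) m = 0" using Fq qm .
      ultimately show ?thesis
        unfolding minus_mps.rep_eq prod conv mps_coeff_W_mult using qm by simp
    qed
  qed
qed

theorem theorem6:
  shows "to_fract (F 1) = to_fract (1 - fps_at_mps F_B (- W 1)) / to_fract (W 1) \<and>
    (\<forall>r\<ge>2. to_fract (F r) =
       1 / to_fract (W r) *
       to_fract (F (r - 1)
         - fps_at_mps F_B (- W r) * mps_subst (W(r - 1 := W (r - 1) + W r)) (F (r - 1))))"
proof (intro conjI allI impI)
  show "to_fract (F 1) = to_fract (1 - fps_at_mps F_B (- W 1)) / to_fract (W 1)"
    \<comment> \<open>Read from right to left, the cleared identity turns the numerator into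
      \<open>W 1 * F 1\<close>, and \<open>W 1\<close> cancels.\<close>
    unfolding W_mult_F_1[symmetric] to_fract_mult by (simp add: W_neq_0)
next
  fix r :: nat
  assume "r \<ge> 2"
  then obtain s where r: "r = Suc (Suc s)" by (metis add_2_eq_Suc le_Suc_ex)
  have r1: "r - 1 = Suc s" by (simp add: r)
  show "to_fract (F r) = 1 / to_fract (W r) * to_fract (F (r - 1)
      - fps_at_mps F_B (- W r) * mps_subst (W(r - 1 := W (r - 1) + W r)) (F (r - 1)))"
    unfolding r1 unfolding r W_mult_F[symmetric] to_fract_mult by (simp add: W_neq_0)
qed

end
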